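(* Let $\varepsilon>0$. Assuming $(1+\varepsilon)$-multiplicative approximation queries, any algorithm requires at least $n\cdot\frac{\varepsilon}{4}$ queries to detect the target $t$. (This is a worst-case lower bound: there is a graph $G$ with $n$ vertices such that, for every algorithm that detects the unknown target in $G$, some position of the target and some valid, adversarially chosen $(1+\varepsilon)$-multiplicative approximation query responses force the algorithm to make at least $n\cdot\frac{\varepsilon}{4}$ queries.)
   Context: Graphs $G=(V,E)$ with $|V|=n$ are connected, simple and undirected, and are given along with a weight function $w:E\to\mathbb{R}^+$ on the edges (the graph is unweighted if all weights are $1$). The distance $d(v,u)$ is the length of a shortest path between $v$ and $u$ with respect to $w$, and $N(v)$ is the set of vertices adjacent to $v$. There is one initially unknown target vertex $t\in V$, which the algorithm must detect by querying vertices. A $(1+\varepsilon)$-multiplicative approximation query at a vertex $v\in V$ returns a (possibly adversarially chosen) neighbor $u\in N(v)$ such that $w(vu)+d(u,t)\le(1+\varepsilon)\cdot d(v,t)$; if the queried vertex $v$ equals $t$, this is revealed by the query.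
   Formalization: The bound is stated only for n·ε/4 ≤ n−1; when n·ε/4 exceeds n−1 the claim is false, because querying all vertices but one always detects the target with at most n−1 queries. *)

theory Defs
  imports "Graph_Theory.Graph_Theory"
begin

text \<open>
  An adaptive deterministic algorithm is a decision tree: it either stops and announces a vertex
  as the target, or queries a vertex and continues depending on the response.  The type is
  inductive, so every algorithm halts after finitely many queries whatever the responses are.
\<close>

datatype 'v response = Found | Towards 'v

datatype 'v algorithm = Announce 'v | Query 'v "'v response \<Rightarrow> 'v algorithm"

text \<open>
  Undirected graphs are symmetric loop-free digraphs without parallel arcs (locale
  \<^locale>\<open>pair_graph\<close>); accordingly an edge weight is a weight on arcs that is invariant under
  reversal.  The distance is the library's \<open>\<mu>\<close>, of type \<^typ>\<open>ereal\<close>; it is finite for all pairs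
  of vertices, since the graph is connected.
\<close>

locale connected_weighted_graph = pair_graph G
  for G :: "'v pair_pre_digraph" +
  fixes w :: "('v \<times> 'v) weight_fun"
  assumes connected_graph: "connected (with_proj G)"
    and weight_pos: "e \<in> parcs G \<Longrightarrow> 0 < w e"
    and weight_sym: "(u, v) \<in> parcs G \<Longrightarrow> w (u, v) = w (v, u)"
begin

text \<open>The admissible responses to a query at \<open>v\<close> when the target is \<open>t\<close>:\<close>

fun approx_response :: "real \<Rightarrow> 'v \<Rightarrow> 'v \<Rightarrow> 'v response \<Rightarrow> bool" where
  "approx_response \<epsilon> t v Found \<longleftrightarrow> v = t"
| "approx_response \<epsilon> t v (Towards u) \<longleftrightarrow>
     v \<noteq> t \<and> (v, u) \<in> parcs G \<and> ereal (w (v, u)) + \<mu> w u t \<le> ereal (1 + \<epsilon>) * \<mu> w v t"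

primrec queries_vertices :: "'v algorithm \<Rightarrow> bool" where
  "queries_vertices (Announce a) \<longleftrightarrow> True"
| "queries_vertices (Query v A) \<longleftrightarrow> v \<in> pverts G \<and> (\<forall>r. queries_vertices (A r))"

text \<open>
  \<open>run \<epsilon> t A k a\<close>: for the target \<open>t\<close> there are admissible responses to the queries of \<open>A\<close> under
  which \<open>A\<close> makes exactly \<open>k\<close> queries and then announces \<open>a\<close>.
\<close>

inductive run :: "real \<Rightarrow> 'v \<Rightarrow> 'v algorithm \<Rightarrow> nat \<Rightarrow> 'v \<Rightarrow> bool" for \<epsilon> t where
  announce: "run \<epsilon> t (Announce a) 0 a"
| query: "approx_response \<epsilon> t v r \<Longrightarrow> run \<epsilon> t (A r) k a \<Longrightarrow> run \<epsilon> t (Query v A) (Suc k) a"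

definition detects :: "real \<Rightarrow> 'v algorithm \<Rightarrow> bool" where
  "detects \<epsilon> A \<longleftrightarrow> queries_vertices A \<and> (\<forall>t \<in> pverts G. \<forall>k a. run \<epsilon> t A k a \<longrightarrow> a = t)"

end

text \<open>
  Querying all vertices but one always detects the target, so no lower bound beyond
  \<open>card (pverts G) - 1\<close> can hold.
\<close>

primrec sweep :: "'v \<Rightarrow> 'v list \<Rightarrow> 'v algorithm" where
  "sweep z [] = Announce z"
| "sweep z (v # vs) = Query v (\<lambda>r. if r = Found then Announce v else sweep z vs)"

context connected_weighted_graph begin

inductive_cases run_AnnounceE: "run \<epsilon> t (Announce b) k a"
inductive_cases run_QueryE: "run \<epsilon> t (Query v A) k a"

lemma run_sweep:
  "run \<epsilon> t (sweep z us) k a \<Longrightarrow> t \<in> insert z (set us) \<Longrightarrow> k \<le> length us \<and> a = t"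
proof (induction us arbitrary: k)
  case Nil
  from Nil.prems(1) have "run \<epsilon> t (Announce z) k a" by simp
  then have "k = 0" "a = z" by (rule run_AnnounceE, simp)+
  with Nil.prems(2) show ?case by simp
next
  case (Cons v us)
  from Cons.prems(1)
  have "run \<epsilon> t (Query v (\<lambda>r. if r = Found then Announce v else sweep z us)) k a" by simp
  then obtain r j where j: "k = Suc j" "approx_response \<epsilon> t v r"
    "run \<epsilon> t (if r = Found then Announce v else sweep z us) j a"
    by (rule run_QueryE)
  show ?case
  proof (cases r)
    case Found
    with j(3) have "run \<epsilon> t (Announce v) j a" by simp
    then have "j = 0" "a = v" by (rule run_AnnounceE, simp)+
    moreover have "v = t" using j(2) Found by simp
    ultimately show ?thesis using j(1) by simp
  next
    case (Towards u)
    then have "run \<epsilon> t (sweep z us) j a" "v \<noteq> t" using j(2,3) by simp_all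
    moreover from this Cons.prems(2) have "t \<in> insert z (set us)" by simp
    ultimately have "j \<le> length us \<and> a = t" by (intro Cons.IH)
    then show ?thesis using j(1) by simp
  qed
qed

lemma queries_vertices_sweep: "set us \<subseteq> pverts G \<Longrightarrow> queries_vertices (sweep z us)"
  by (induction us) simp_all

lemma ex_detects_card_minus_1:
  "\<exists>A. detects \<epsilon> A \<and> (\<forall>t \<in> pverts G. \<forall>k a. run \<epsilon> t A k a \<longrightarrow> k \<le> card (pverts G) - 1)"
proof -
  have "verts (mk_symmetric (with_proj G)) \<noteq> {}"
    using connected_graph unfolding connected_def strongly_connected_def by (rule conjunct1)
  then obtain z where z: "z \<in> pverts G" by (simp add: ex_in_conv[symmetric]) (erule exE)
  have "finite (pverts G - {z})"
    using pair_finite_verts by (rule finite_Diff)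
  then obtain vs where vs: "set vs = pverts G - {z}" "distinct vs"
    using finite_distinct_list by metis
  have len: "length vs = card (pverts G) - 1"
    using distinct_card[OF vs(2)] vs(1) card_Diff_singleton[OF z] by metis
  have ins: "insert z (set vs) = pverts G"
    unfolding vs(1) using z by (rule insert_Diff)
  have run: "k \<le> length vs \<and> a = t" if "t \<in> pverts G" "run \<epsilon> t (sweep z vs) k a" for t k a
    using that(2) by (rule run_sweep) (simp only: ins that(1))
  have "queries_vertices (sweep z vs)"
    by (rule queries_vertices_sweep) (simp only: vs(1) Diff_subset)
  then have "detects \<epsilon> (sweep z vs)"
    unfolding detects_def by (intro conjI ballI allI impI) (simp_all only: run)
  moreover have "\<forall>t \<in> pverts G. \<forall>k a. run \<epsilon> t (sweep z vs) k a \<longrightarrow> k \<le> card (pverts G) - 1"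
    unfolding len[symmetric] by (intro ballI allI impI) (simp only: run)
  ultimately show ?thesis by (intro exI conjI)
qed

end

end

theory Submission
  imports Defs
begin

text \<open>
  The witness is a weighted star with centre \<open>0\<close>: the edge to the leaf \<open>1\<close> has weight \<open>\<epsilon> / 2\<close>, the
  edges to all other leaves have weight \<open>1\<close>.  For a target at another leaf the detour from the centre
  through leaf \<open>1\<close> costs \<open>1 + \<epsilon>\<close>, so the centre may always answer with leaf \<open>1\<close>, and every leaf
  must answer with the centre.  These answers do not depend on the target, so a failed query excludes
  nothing but the queried vertex, and \<open>n - 1\<close> queries are necessary.
\<close>

context connected_weighted_graph begin

text \<open>\<open>run\<close> only asserts that suitable responses exist, so a lower bound on query
  counts says something only once some run is exhibited. Answering \<open>Found\<close> at
  \<open>t\<close> and \<open>f v\<close> elsewhere never gets stuck.\<close>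

lemma ex_run_if_oblivious:
  assumes "\<And>v. v \<in> pverts G \<Longrightarrow> v \<noteq> t \<Longrightarrow> approx_response \<epsilon> t v (Towards (f v))"
    and "queries_vertices A"
  shows "\<exists>k a. run \<epsilon> t A k a"
  using assms(2)
proof (induction A)
  case (Announce a)
  then show ?case by (blast intro: run.announce)
next
  case (Query v A)
  then have IH: "\<exists>k a. run \<epsilon> t (A r) k a" for r by auto
  have "\<exists>r. approx_response \<epsilon> t v r"
  proof (cases "v = t")
    case True
    then have "approx_response \<epsilon> t v Found" by simp
    then show ?thesis by blast
  next
    case False
    with assms(1) Query.prems show ?thesis by (meson queries_vertices.simps(2))
  qed
  with IH show ?case by (meson run.query)
qed

text \<open>\<open>X\<close> is the set of targets consistent with the answers so far. Since
  \<open>f\<close> ignores the target, a query at \<open>v\<close> removes at most \<open>v\<close>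
  from \<open>X\<close>, and an algorithm may announce only when one candidate is left. Correctness
  is required on \<open>X\<close> alone, because a subtree need not be correct for targets already
  excluded.\<close>

lemma oblivious_lower_bound:
  assumes f: "\<And>t v. t \<in> pverts G \<Longrightarrow> v \<in> pverts G \<Longrightarrow> v \<noteq> t \<Longrightarrow>
      approx_response \<epsilon> t v (Towards (f v))"
    and "queries_vertices A"
    and "X \<subseteq> pverts G" "X \<noteq> {}"
    and "\<And>t k a. t \<in> X \<Longrightarrow> run \<epsilon> t A k a \<Longrightarrow> a = t"
  shows "\<exists>t\<in>X. \<exists>k a. run \<epsilon> t A k a \<and> card X \<le> Suc k"
  using assms(2-)
proof (induction A arbitrary: X)
  case (Announce a)
  then have "X = {a}" by (fastforce intro: run.announce)
  then show ?case by (auto intro: run.announce)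
next
  case (Query v A)
  show ?case
  \<comment> \<open>With \<open>X = {v}\<close> no candidate would survive the query, but then
    \<open>card X = 1\<close> and any run for \<open>v\<close> will do.\<close>
  proof (cases "X = {v}")
    case True
    have "\<exists>k a. run \<epsilon> v (Query v A) k a"
      using Query.prems True by (intro ex_run_if_oblivious[of _ _ f] f) auto
    then show ?thesis using True by auto
  next
    case False
    have step: "run \<epsilon> t (Query v A) (Suc k) a"
      if "t \<in> X - {v}" "run \<epsilon> t (A (Towards (f v))) k a" for t k a
      using that Query.prems(1,2) by (intro run.query[of _ _ _ "Towards (f v)"] f) auto
    have "\<exists>t\<in>X - {v}. \<exists>k a. run \<epsilon> t (A (Towards (f v))) k a \<and> card (X - {v}) \<le> Suc k"
    proof (rule Query.IH)
      show "a = t" if "t \<in> X - {v}" "run \<epsilon> t (A (Towards (f v))) k a" for t k a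
        using step[OF that] Query.prems(4) that(1) by blast
    qed (use Query.prems False in auto)
    then obtain t k a where "t \<in> X - {v}" "run \<epsilon> t (A (Towards (f v))) k a"
      "card (X - {v}) \<le> Suc k"
      by blast
    moreover from this(3) have "card X \<le> Suc (Suc k)"
      by (simp add: card_Diff_singleton_if split: if_splits)
    ultimately show ?thesis using step by blast
  qed
qed

end

definition star :: "nat \<Rightarrow> nat pair_pre_digraph" where
  "star n = \<lparr>pverts = {..<n}, parcs = {0} \<times> {1..<n} \<union> {1..<n} \<times> {0}\<rparr>"

definition star_weight :: "real \<Rightarrow> (nat \<times> nat) weight_fun" where
  "star_weight \<epsilon> = (\<lambda>(u, v). if {u, v} = {0, 1} then \<epsilon> / 2 else 1)"

lemma star_simps [simp]:
  "pverts (star n) = {..<n}"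
  "(u, v) \<in> parcs (star n) \<longleftrightarrow> u < n \<and> v < n \<and> (u = 0 \<longleftrightarrow> v \<noteq> 0)"
  by (auto simp: star_def)

lemma pair_graph_star: "pair_graph (star n)"
proof
  show "finite (parcs (star n))" by (simp add: star_def)
qed (auto simp: symmetric_def sym_def)

lemma connected_star:
  assumes "0 < n"
  shows "connected (with_proj (star n))"
proof -
  interpret pair_graph "star n" by (rule pair_graph_star)
  have to0: "u \<rightarrow>\<^sup>*\<^bsub>star n\<^esub> 0" and from0: "0 \<rightarrow>\<^sup>*\<^bsub>star n\<^esub> u" if "u < n" for u
    using that assms by (cases "u = 0"; auto)+
  show ?thesis
    using assms
    by (auto intro!: connectedI reachable_mk_symmetricI intro: reachable_trans[OF to0 from0])
qed

lemma connected_weighted_graph_star: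
  assumes "0 < n" "0 < \<epsilon>"
  shows "connected_weighted_graph (star n) (star_weight \<epsilon>)"
proof -
  interpret pair_graph "star n" by (rule pair_graph_star)
  show ?thesis
    using assms connected_star[of n]
    by unfold_locales (auto simp: star_weight_def insert_commute split: prod.split)
qed

lemma approx_response_star:
  assumes n: "t < n" "v < n" "v \<noteq> t" and \<epsilon>: "0 < \<epsilon>"
  shows "connected_weighted_graph.approx_response (star n) (star_weight \<epsilon>) \<epsilon> t v
    (Towards (if v = 0 then 1 else 0))"
proof -
  interpret connected_weighted_graph "star n" "star_weight \<epsilon>"
    using assms by (intro connected_weighted_graph_star) auto
  let ?w = "star_weight \<epsilon>"
  have nonneg: "0 \<le> awalk_cost ?w p" if "awalk u p x" for u x p
    using that weight_pos by (intro pos_cost_pos_awalk_cost) (auto intro: less_imp_le)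
  have mu_nonneg: "0 \<le> \<mu> ?w u x" for u x
    unfolding \<mu>_def using nonneg by (auto intro!: INF_greatest)
  show ?thesis
  proof (cases "v = 0")
    case False
    \<comment> \<open>The only arc leaving a leaf goes to the centre, so this response is exact: it
      meets the bound even with factor \<open>1\<close>.\<close>
    have "ereal (?w (v, 0)) + \<mu> ?w 0 t \<le> ereal (awalk_cost ?w p)" if p: "awalk v p t" for p
    proof (cases p)
      case Nil
      then show ?thesis using p n by (simp add: awalk_Nil_iff)
    next
      case (Cons e q)
      with p False have "e = (v, 0)" "awalk 0 q t"
        by (cases e; auto simp: awalk_Cons_iff)+
      with Cons show ?thesis using min_cost_le_walk_cost[of 0 q t ?w]
        by (auto simp flip: plus_ereal.simps intro: add_left_mono)
    qed
    then have "ereal (?w (v, 0)) + \<mu> ?w 0 t \<le> \<mu> ?w v t"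
      unfolding \<mu>_def[of _ v] by (auto intro!: INF_greatest)
    also have "\<dots> = ereal 1 * \<mu> ?w v t" by simp
    also have "\<dots> \<le> ereal (1 + \<epsilon>) * \<mu> ?w v t"
      using \<epsilon> mu_nonneg by (intro ereal_mult_right_mono) auto
    finally show ?thesis using False n by simp
  next
    case True
    \<comment> \<open>Here \<open>t\<close> is a leaf, so a walk that reaches it from elsewhere uses
      the arc \<open>(0, t)\<close>, and all other arcs only add to the cost. The start
      \<open>u\<close> varies for the induction.\<close>
    have lower: "?w (0, t) \<le> awalk_cost ?w p" if "awalk u p t" "u \<noteq> t" for u p
      using that
    proof (induction p arbitrary: u)
      case Nil
      then show ?case by (simp add: awalk_Nil_iff)
    next
      case (Cons e q)
      then obtain x where e: "e = (u, x)" "(u, x) \<in> parcs (star n)" "awalk x q t"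
        by (cases e) (auto simp: awalk_Cons_iff)
      show ?case
      proof (cases "x = t")
        case True
        with \<open>v = 0\<close> n e have "u = 0" by auto
        with True e nonneg[OF e(3)] show ?thesis by simp
      next
        case False
        with Cons.IH[OF e(3)] e weight_pos[OF e(2)] show ?thesis by simp
      qed
    qed
    have mu0: "ereal (?w (0, t)) \<le> \<mu> ?w 0 t"
      unfolding \<mu>_def using lower n True by (auto intro!: INF_greatest)
    have n1: "1 < n" using n True by linarith
    \<comment> \<open>For \<open>t \<noteq> 1\<close> this is tight: going to leaf \<open>1\<close>
      and back costs \<open>\<epsilon> / 2 + \<epsilon> / 2\<close>, and the last arc costs
      \<open>1\<close>.\<close>
    have "\<exists>p. awalk 1 p t \<and> ?w (0, 1) + awalk_cost ?w p \<le> (1 + \<epsilon>) * ?w (0, t)"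
    proof (cases "t = 1")
      case True
      then have "awalk 1 [] t" using n by (simp add: awalk_Nil_iff)
      moreover have "?w (0, 1) + awalk_cost ?w [] \<le> (1 + \<epsilon>) * ?w (0, t)"
        using True \<epsilon> by (simp add: star_weight_def)
      ultimately show ?thesis by blast
    next
      case False
      have "awalk 1 [(1, 0), (0, t)] t"
        using n n1 \<open>v = 0\<close> by (auto simp: awalk_Cons_iff awalk_Nil_iff)
      moreover have "?w (0, 1) + awalk_cost ?w [(1, 0), (0, t)] \<le> (1 + \<epsilon>) * ?w (0, t)"
        using False \<epsilon> by (auto simp: star_weight_def doubleton_eq_iff)
      ultimately show ?thesis by blast
    qed
    then obtain p where p: "awalk 1 p t" "?w (0, 1) + awalk_cost ?w p \<le> (1 + \<epsilon>) * ?w (0, t)"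
      by blast
    have "ereal (?w (0, 1)) + \<mu> ?w 1 t \<le> ereal (?w (0, 1)) + ereal (awalk_cost ?w p)"
      using min_cost_le_walk_cost[OF p(1)] by (intro add_left_mono)
    also have "\<dots> \<le> ereal (1 + \<epsilon>) * ereal (?w (0, t))" using p(2) by simp
    also have "\<dots> \<le> ereal (1 + \<epsilon>) * \<mu> ?w 0 t"
      using mu0 \<epsilon> by (intro ereal_mult_left_mono) auto
    finally show ?thesis using True n n1 by simp
  qed
qed

theorem theorem2:
  fixes \<epsilon> :: real and n :: nat
  assumes "\<epsilon> > 0"
    and "real n * (\<epsilon> / 4) \<le> real n - 1"
  shows "\<exists>(G :: nat pair_pre_digraph) w.
           connected_weighted_graph G w \<and> card (pverts G) = n \<and>
           (\<forall>A. connected_weighted_graph.detects G w \<epsilon> A \<longrightarrow>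
             (\<exists>t \<in> pverts G. \<exists>k a. connected_weighted_graph.run G w \<epsilon> t A k a \<and>
               real n * (\<epsilon> / 4) \<le> real k))"
proof -
  \<comment> \<open>For \<open>n = 0\<close> the second assumption would read
    \<open>0 \<le> -1\<close>.\<close>
  have "0 < n" using assms(2) by (cases n) auto
  then interpret connected_weighted_graph "star n" "star_weight \<epsilon>"
    using assms(1) by (rule connected_weighted_graph_star)
  have "\<exists>t \<in> pverts (star n). \<exists>k a. run \<epsilon> t A k a \<and> real n * (\<epsilon> / 4) \<le> real k"
    if "detects \<epsilon> A" for A
  proof -
    have "\<exists>t \<in> pverts (star n). \<exists>k a. run \<epsilon> t A k a \<and> card (pverts (star n)) \<le> Suc k"
      using that \<open>0 < n\<close> assms(1)
      by (intro oblivious_lower_bound[where f = "\<lambda>v. if v = 0 then 1 else 0"] approx_response_star)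
        (auto simp: detects_def)
    then obtain t k a where "t \<in> pverts (star n)" "run \<epsilon> t A k a" "n \<le> Suc k" by auto
    \<comment> \<open>The run has \<open>k \<ge> n - 1\<close>, and the second assumption places the
      claimed bound below \<open>n - 1\<close>.\<close>
    moreover from this(3) assms(2) have "real n * (\<epsilon> / 4) \<le> real k" by linarith
    ultimately show ?thesis by blast
  qed
  then show ?thesis
    by (intro exI[of _ "star n"] exI[of _ "star_weight \<epsilon>"])
      (simp add: connected_weighted_graph_axioms)
qed

end
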